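(* For $n\ge1$, \[ \sum_{j=0}^{n}\binom{n}{j}(x+j)^{n-1}=n!\,(n-1)!\sum_{j=0}^{n-1}\sum_{l=0}^{j}\sum_{k=j+1}^{n}\frac{\binom{n}{k}2^kS_2(l+n,n)S_1(k-1,j)\,j!}{(l+n)!\,(k-1)!\,(j-l)!}(x-1)^{j-l}. \]
   Context: $S_2(n,k)$ are the Stirling numbers of the second kind, and $S_1(n,k)$ are the (signed) Stirling numbers of the first kind, defined by $(x)_n=x(x-1)\cdots(x-n+1)=\sum_{k=0}^nS_1(n,k)x^k$. *)

theory Defs
  imports
    "HOL-Combinatorics.Stirling"
    "HOL-Computational_Algebra.Polynomial"
begin

text \<open>
  The library's \<open>stirling\<close> is the unsigned version of the numbers of the first kind.
  The signed ones are the coefficients of the falling factorial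
  \<open>x (x - 1) \<dots> (x - n + 1)\<close> read as a polynomial in \<open>x\<close>.
\<close>

definition falling_factorial_poly :: "nat \<Rightarrow> int poly" where
  "falling_factorial_poly n = (\<Prod>i<n. [:- int i, 1:])"

definition stirling1_signed :: "nat \<Rightarrow> nat \<Rightarrow> int" where
  "stirling1_signed n k = coeff (falling_factorial_poly n) k"

lemma degree_falling_factorial_poly: "degree (falling_factorial_poly n) = n"
  unfolding falling_factorial_poly_def by (subst degree_prod_eq_sum_degree) auto

lemma falling_factorial_eq_sum_stirling1_signed:
  fixes x :: "'a :: comm_ring_1"
  shows "(\<Prod>i<n. x - of_nat i) = (\<Sum>k\<le>n. of_int (stirling1_signed n k) * x ^ k)"
proof (induction n)
  case 0
  show ?case by (simp add: stirling1_signed_def falling_factorial_poly_def)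
next
  case (Suc n)
  let ?s = stirling1_signed
  have "falling_factorial_poly (Suc n) =
      pCons 0 (falling_factorial_poly n) - smult (int n) (falling_factorial_poly n)"
    by (simp add: falling_factorial_poly_def mult.commute)
  then have s0: "?s (Suc n) 0 = - int n * ?s n 0"
    and sSuc: "?s (Suc n) (Suc k) = ?s n k - int n * ?s n (Suc k)" for k
    by (simp_all add: stirling1_signed_def)
  have top: "?s n (Suc n) = 0"
    by (simp add: stirling1_signed_def coeff_eq_0 degree_falling_factorial_poly)
  have "(\<Sum>k\<le>n. of_int (?s n k) * x ^ k) = (\<Sum>k\<le>Suc n. of_int (?s n k) * x ^ k)"
    by (simp add: top)
  also have "\<dots> = of_int (?s n 0) + (\<Sum>k\<le>n. of_int (?s n (Suc k)) * x ^ Suc k)"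
    by (subst sum.atMost_Suc_shift) simp
  finally have shift: "(\<Sum>k\<le>n. of_int (?s n (Suc k)) * x ^ Suc k) =
      (\<Sum>k\<le>n. of_int (?s n k) * x ^ k) - of_int (?s n 0)"
    by (simp add: algebra_simps)
  have "(\<Sum>k\<le>Suc n. of_int (?s (Suc n) k) * x ^ k) =
      of_int (?s (Suc n) 0) + (\<Sum>k\<le>n. of_int (?s (Suc n) (Suc k)) * x ^ Suc k)"
    by (subst sum.atMost_Suc_shift) simp
  also have "(\<Sum>k\<le>n. of_int (?s (Suc n) (Suc k)) * x ^ Suc k) =
      x * (\<Sum>k\<le>n. of_int (?s n k) * x ^ k)
      - of_nat n * (\<Sum>k\<le>n. of_int (?s n (Suc k)) * x ^ Suc k)"
    by (simp add: sSuc sum_subtractf sum_distrib_left algebra_simps)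
  finally show ?case
    unfolding shift s0 using Suc by (simp add: algebra_simps)
qed

end

theory Submission
  imports Defs "HOL-Computational_Algebra.Formal_Power_Series"
begin

unbundle fps_syntax

text \<open>
  Put \<open>A = (e\<^sup>t - 1) / t\<close>. The powers of \<open>A\<close> generate the Stirling numbers of the second
  kind. Those of the first kind satisfy \<open>S\<^sub>1(m, j) j! / m! = [t\<^bsup>m-j\<^esup>] e\<^sup>t A\<^bsup>-(m+1)\<^esup>\<close>: this follows
  from the case of Lagrange inversion \<open>binom(y, m) = [t\<^bsup>m\<^esup>] e\<^bsup>(y+1)t\<^esup> A\<^bsup>-(m+1)\<^esup>\<close>, which is a
  recurrence in \<open>m\<close> read off from \<open>t B' = B - B\<^sup>2 e\<^sup>t\<close> for \<open>B = 1 / A\<close>. So the sum over \<open>j\<close> and \<open>l\<close>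
  on the right-hand side is the Cauchy product
  \<open>[t\<^bsup>k-1\<^esup>] (e\<^sup>t A\<^bsup>-k\<^esup>) (e\<^bsup>(x-1)t\<^esup> A\<^bsup>n\<^esup>) = [t\<^bsup>n-1\<^esup>] e\<^bsup>xt\<^esup> (e\<^sup>t - 1)\<^bsup>n-k\<^esup>\<close>, and summing over \<open>k\<close> with
  weights \<open>binom(n, k) 2\<^bsup>k\<^esup>\<close> gives \<open>[t\<^bsup>n-1\<^esup>] e\<^bsup>xt\<^esup> (1 + e\<^sup>t)\<^bsup>n\<^esup>\<close>.
\<close>

text \<open>Writing E = e^t - 1, we get E' = 1 + E, so (E^(m+1))' = (m+1) (E^m + E^(m+1)). Comparing
  coefficients gives the Stirling recurrence.\<close>

lemma fps_exp_minus_one_power_nth: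
  "((fps_exp 1 - 1) ^ n :: 'a :: field_char_0 fps) $ N
    = fact n * of_nat (Stirling N n) / fact N"
proof (induction N arbitrary: n)
  case 0
  show ?case by (cases n) (simp_all add: fps_power_zeroth)
next
  case (Suc N)
  show ?case
  proof (cases n)
    case 0
    then show ?thesis by simp
  next
    case (Suc m)
    let ?E = "fps_exp 1 - 1 :: 'a fps"
    have "fps_deriv (?E ^ Suc m) = of_nat (Suc m) * (?E ^ m + ?E ^ Suc m)"
      by (subst fps_deriv_power') (simp add: algebra_simps)
    then have "fps_deriv (?E ^ Suc m) $ N = of_nat (Suc m) * ((?E ^ m) $ N + (?E ^ Suc m) $ N)"
      by (simp only: fps_mult_of_nat_nth fps_add_nth)
    then have "of_nat (Suc N) * (?E ^ n) $ Suc N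
        = of_nat (Suc m) * ((?E ^ m) $ N + (?E ^ Suc m) $ N)"
      using Suc by (simp only: fps_deriv_nth Suc_eq_plus1)
    also have "\<dots> = fact (Suc m) * of_nat (Stirling (Suc N) (Suc m)) / fact N"
      by (simp only: Suc.IH Stirling.simps) (simp add: field_simps)
    finally show ?thesis
      using Suc by (simp add: field_simps del: of_nat_Suc power_Suc Stirling.simps)
  qed
qed

text \<open>This is the series \<open>A\<close> above; shifting by one divides e^t - 1 by t. The
  constant term is 1, so \<open>inverse\<close> is a true inverse.\<close>

definition fps_expdiff :: "'a :: field_char_0 fps" where
  "fps_expdiff = fps_shift 1 (fps_exp 1 - 1)"

lemma fps_expdiff_nth_0 [simp]: "fps_expdiff $ 0 = 1"
  by (simp add: fps_expdiff_def)

lemma fps_exp_minus_one_eq: "fps_exp 1 - 1 = fps_X * fps_expdiff"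
  by (simp add: fps_expdiff_def fps_eq_iff)

lemma fps_expdiff_power_nth:
  "(fps_expdiff ^ n :: 'a :: field_char_0 fps) $ l
    = fact n * of_nat (Stirling (l + n) n) / fact (l + n)"
proof -
  have "((fps_exp 1 - 1) ^ n :: 'a fps) $ (l + n) = (fps_expdiff ^ n) $ l"
    by (simp add: fps_exp_minus_one_eq power_mult_distrib fps_X_power_mult_nth)
  then show ?thesis by (simp add: fps_exp_minus_one_power_nth)
qed

lemma fps_expdiff_inverse [simp]: "fps_expdiff * inverse fps_expdiff = 1"
  by (simp add: inverse_mult_eq_1')

lemma fps_X_mult_deriv_inverse_expdiff:
  "fps_X * fps_deriv (inverse fps_expdiff :: 'a :: field_char_0 fps)
    = inverse fps_expdiff - inverse fps_expdiff ^ 2 * fps_exp 1"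
proof -
  define A B :: "'a fps" where "A = fps_expdiff" and "B = inverse fps_expdiff"
  have AB: "A * B = 1" by (simp add: A_def B_def)
  have "fps_deriv (fps_exp 1 - 1 :: 'a fps) = fps_deriv (fps_X * A)"
    by (simp only: fps_exp_minus_one_eq A_def)
  then have dA: "fps_exp 1 = A + fps_X * fps_deriv A"
    by (simp add: algebra_simps)
  have "fps_deriv (A * B) = 0" by (simp add: AB)
  \<comment> \<open>The factor \<open>B\<close> turns the coefficient \<open>A\<close> of B' into A
    B = 1.\<close>
  then have "B * (A * fps_deriv B + fps_deriv A * B) = 0" by simp
  then have "(A * B) * fps_deriv B = - (B ^ 2 * fps_deriv A)"
    by (simp add: algebra_simps power2_eq_square eq_neg_iff_add_eq_0)
  then have dB: "fps_deriv B = - (B ^ 2 * fps_deriv A)" by (simp add: AB)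
  have "fps_X * fps_deriv B = (A * B) * B - B ^ 2 * (A + fps_X * fps_deriv A)"
    unfolding dB by (simp add: algebra_simps power2_eq_square)
  also have "\<dots> = B - B ^ 2 * fps_exp 1"
    by (simp add: AB flip: dA)
  finally show ?thesis by (simp add: B_def)
qed

text \<open>Compare coefficients of t^(m+1) in t W' for W = e^(yt) B^(m+1). The operator t d/dt
  multiplies that coefficient of W by m+1, which is also the exponent of B, so it cancels.\<close>

lemma exp_inverse_expdiff_recurrence:
  fixes y :: "'a :: field_char_0"
  shows "of_nat (Suc m) * (fps_exp (y + 1) * inverse fps_expdiff ^ Suc (Suc m)) $ Suc m
    = y * (fps_exp y * inverse fps_expdiff ^ Suc m) $ m"
proof -
  define B :: "'a fps" where "B = inverse fps_expdiff"
  define W where "W = fps_exp y * B ^ Suc m"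
  define V where "V = fps_exp (y + 1) * B ^ Suc (Suc m)"
  have XB: "fps_X * fps_deriv B = B - B ^ 2 * fps_exp 1"
    unfolding B_def by (rule fps_X_mult_deriv_inverse_expdiff)
  have "fps_X * fps_deriv W
      = fps_const y * (fps_X * W)
        + of_nat (Suc m) * (fps_exp y * B ^ m * (fps_X * fps_deriv B))"
    unfolding W_def fps_deriv_mult
    by (subst fps_deriv_power') (simp add: algebra_simps)
  also have "\<dots> = fps_const y * (fps_X * W) + of_nat (Suc m) * (W - V)"
    unfolding XB W_def V_def
    by (simp add: algebra_simps power2_eq_square fps_exp_add_mult)
  finally have "(fps_X * fps_deriv W) $ Suc m
      = (fps_const y * (fps_X * W) + of_nat (Suc m) * (W - V)) $ Suc m"
    by simp
  then have "of_nat (Suc m) * W $ Suc m = y * W $ m + of_nat (Suc m) * (W $ Suc m - V $ Suc m)"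
    by (simp del: of_nat_Suc add: fps_mult_of_nat_nth)
  then show ?thesis
    by (simp add: W_def V_def B_def algebra_simps del: of_nat_Suc power_Suc)
qed

text \<open>Splitting off the factor y leaves the falling factorial of y - 1, so \<open>y\<close>
  must vary in the induction; its series e^((y-1)+1)t is the one in the recurrence.\<close>

lemma falling_factorial_eq_nth:
  fixes y :: "'a :: field_char_0"
  shows "(\<Prod>i<m. y - of_nat i)
    = fact m * (fps_exp (y + 1) * inverse fps_expdiff ^ Suc m) $ m"
proof (induction m arbitrary: y)
  case 0
  show ?case by simp
next
  case (Suc m)
  have "(\<Prod>i<Suc m. y - of_nat i) = y * (\<Prod>i<m. (y - 1) - of_nat i)"
    by (subst prod.lessThan_Suc_shift) (simp add: algebra_simps)
  also have "\<dots> = fact m * (y * (fps_exp y * inverse fps_expdiff ^ Suc m) $ m)"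
    by (subst Suc.IH) simp
  also have "\<dots> = fact (Suc m) *
      (fps_exp (y + 1) * inverse fps_expdiff ^ Suc (Suc m)) $ Suc m"
    by (subst exp_inverse_expdiff_recurrence [symmetric]) (simp add: algebra_simps)
  finally show ?case .
qed

text \<open>Both expressions for the falling factorial are polynomials in y. They agree at every
  point of an infinite field, hence coefficientwise; y^i enters e^(yt) G at t^m with coefficient
  [t^(m-i)] G / i!.\<close>

lemma stirling1_signed_eq_nth:
  assumes "j \<le> m"
  shows "of_int (stirling1_signed m j) * fact j / fact m
    = (fps_exp 1 * inverse fps_expdiff ^ Suc m :: 'a :: field_char_0 fps) $ (m - j)"
proof -
  define G :: "'a fps" where "G = fps_exp 1 * inverse fps_expdiff ^ Suc m"
  define p q :: "'a poly" where
    "p = (\<Sum>i\<le>m. monom (of_int (stirling1_signed m i)) i)" and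
    "q = (\<Sum>i\<le>m. monom (fact m / fact i * G $ (m - i)) i)"
  have "poly p y = poly q y" for y
  proof -
    have "poly p y = fact m * (fps_exp (y + 1) * inverse fps_expdiff ^ Suc m) $ m"
      by (simp add: p_def poly_sum poly_monom falling_factorial_eq_nth
          flip: falling_factorial_eq_sum_stirling1_signed del: power_Suc)
    also have "fps_exp (y + 1) * inverse fps_expdiff ^ Suc m = fps_exp y * G"
      by (simp add: G_def fps_exp_add_mult mult_ac)
    also have "fact m * (fps_exp y * G) $ m = poly q y"
      unfolding fps_mult_nth
      by (simp add: q_def poly_sum poly_monom sum_distrib_left atMost_atLeast0 mult_ac)
    finally show ?thesis .
  qed
  then have "p = q" by (simp add: fun_eq_iff flip: poly_eq_poly_eq_iff)
  then have "coeff p j = coeff q j" by simp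
  with assms show ?thesis
    by (simp add: p_def q_def coeff_sum if_distrib [where f = "\<lambda>c. coeff c _"] G_def
        field_simps del: power_Suc)
qed

lemma sum_binomial_power_eq_nth:
  fixes x :: "'a :: field_char_0"
  shows "(\<Sum>j=0..n. of_nat (n choose j) * (x + of_nat j) ^ m)
    = fact m * (fps_exp x * (1 + fps_exp 1) ^ n) $ m"
proof -
  have "fps_exp x * (1 + fps_exp 1) ^ n
      = (\<Sum>j=0..n. of_nat (n choose j) * fps_exp (x + of_nat j))"
    by (subst add.commute, subst binomial_ring)
      (simp add: sum_distrib_left fps_exp_add_mult fps_exp_power_mult mult_ac atMost_atLeast0)
  then show ?thesis
    by (simp add: fps_sum_nth fps_mult_of_nat_nth sum_distrib_left mult_ac)
qed

text \<open>Expand 1 + e^t = 2 + t A binomially; the factor t^(n-k) moves the index n-1 down to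
  k-1.\<close>

lemma exp_mult_one_plus_exp_power_nth:
  fixes x :: "'a :: field_char_0"
  assumes "n \<ge> 1"
  shows "(fps_exp x * (1 + fps_exp 1) ^ n) $ (n - 1)
    = (\<Sum>k=1..n. of_nat (n choose k) * 2 ^ k *
        (fps_exp x * fps_expdiff ^ (n - k)) $ (k - 1))"
proof -
  let ?A = "fps_expdiff :: 'a fps"
  have "1 + fps_exp 1 = 2 + fps_X * ?A"
    by (simp flip: fps_exp_minus_one_eq)
  then have "fps_exp x * (1 + fps_exp 1) ^ n
      = (\<Sum>k=0..n. of_nat (n choose k) * (fps_const (2 ^ k) *
          (fps_X ^ (n - k) * (fps_exp x * ?A ^ (n - k)))))"
    by (simp add: binomial_ring sum_distrib_left power_mult_distrib mult_ac atMost_atLeast0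
        numeral_fps_const fps_const_power)
  then have "(fps_exp x * (1 + fps_exp 1) ^ n) $ (n - 1)
      = (\<Sum>k=0..n. of_nat (n choose k) * (2 ^ k *
          (fps_X ^ (n - k) * (fps_exp x * ?A ^ (n - k))) $ (n - 1)))"
    by (simp only: fps_sum_nth fps_mult_of_nat_nth fps_mult_left_const_nth)
  \<comment> \<open>The term k = 0 carries t^n and contributes nothing at index n-1.\<close>
  also have "\<dots> = (\<Sum>k=1..n. of_nat (n choose k) * (2 ^ k *
          (fps_X ^ (n - k) * (fps_exp x * ?A ^ (n - k))) $ (n - 1)))"
    using assms by (subst sum.atLeast_Suc_atMost) (auto simp: fps_X_power_mult_nth)
  also have "\<dots> = (\<Sum>k=1..n. of_nat (n choose k) * 2 ^ k *
        (fps_exp x * fps_expdiff ^ (n - k)) $ (k - 1))"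
  proof (rule sum.cong)
    fix k assume k: "k \<in> {1..n}"
    then have "\<not> n - 1 < n - k" and "n - 1 - (n - k) = k - 1" by auto
    then show "of_nat (n choose k) * (2 ^ k *
          (fps_X ^ (n - k) * (fps_exp x * ?A ^ (n - k))) $ (n - 1))
        = of_nat (n choose k) * 2 ^ k * (fps_exp x * ?A ^ (n - k)) $ (k - 1)"
      by (simp only: fps_X_power_mult_nth if_False mult.assoc)
  qed simp
  finally show ?thesis .
qed

lemma sum_stirling_products_eq_nth:
  fixes x :: "'a :: field_char_0"
  assumes "1 \<le> k" "k \<le> n"
  shows "(\<Sum>j=0..k-1. of_int (stirling1_signed (k - 1) j) * fact j / fact (k - 1) *
      (\<Sum>l=0..j. fact n * of_nat (Stirling (l + n) n) / fact (l + n)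
        * ((x - 1) ^ (j - l) / fact (j - l))))
    = (fps_exp x * fps_expdiff ^ (n - k)) $ (k - 1)"
proof -
  let ?A = "fps_expdiff :: 'a fps"
  have k: "Suc (k - 1) = k" using assms by simp
  have "(\<Sum>j=0..k-1. of_int (stirling1_signed (k - 1) j) * fact j / fact (k - 1) *
      (\<Sum>l=0..j. fact n * of_nat (Stirling (l + n) n) / fact (l + n)
        * ((x - 1) ^ (j - l) / fact (j - l))))
      = (\<Sum>j=0..k-1. (?A ^ n * fps_exp (x - 1)) $ j *
          (fps_exp 1 * inverse ?A ^ k) $ (k - 1 - j))"
  proof (rule sum.cong)
    fix j assume "j \<in> {0..k-1}"
    then have "of_int (stirling1_signed (k - 1) j) * fact j / fact (k - 1)
        = (fps_exp 1 * inverse ?A ^ k) $ (k - 1 - j)"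
      using stirling1_signed_eq_nth [of j "k - 1"] k by auto
    moreover have "(\<Sum>l=0..j. fact n * of_nat (Stirling (l + n) n) / fact (l + n)
        * ((x - 1) ^ (j - l) / fact (j - l))) = (?A ^ n * fps_exp (x - 1)) $ j"
      by (simp add: fps_mult_nth fps_expdiff_power_nth)
    ultimately show "of_int (stirling1_signed (k - 1) j) * fact j / fact (k - 1) *
      (\<Sum>l=0..j. fact n * of_nat (Stirling (l + n) n) / fact (l + n)
        * ((x - 1) ^ (j - l) / fact (j - l)))
      = (?A ^ n * fps_exp (x - 1)) $ j * (fps_exp 1 * inverse ?A ^ k) $ (k - 1 - j)"
      by (simp only: mult.commute)
  qed simp
  also have "\<dots> = ((?A ^ n * fps_exp (x - 1)) * (fps_exp 1 * inverse ?A ^ k)) $ (k - 1)"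
    by (simp only: fps_mult_nth)
  \<comment> \<open>Since k \<le> n, A^n splits as A^(n-k) A^k, and A^k cancels the inverse
    power.\<close>
  also have "(?A ^ n * fps_exp (x - 1)) * (fps_exp 1 * inverse ?A ^ k)
      = fps_exp (x - 1 + 1) * ?A ^ (n - k) * (?A * inverse ?A) ^ k"
    unfolding fps_exp_add_mult power_mult_distrib
    using power_add [of ?A "n - k" k] assms by (simp add: mult_ac)
  also have "\<dots> = fps_exp x * ?A ^ (n - k)" by simp
  finally show ?thesis .
qed

theorem theorem10:
  fixes x :: "'a :: field_char_0" and n :: nat
  assumes "n \<ge> 1"
  shows "(\<Sum>j=0..n. of_nat (n choose j) * (x + of_nat j) ^ (n - 1)) =
    fact n * fact (n - 1) *
      (\<Sum>j=0..n-1. \<Sum>l=0..j. \<Sum>k=j+1..n.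
        (of_nat (n choose k) * 2 ^ k * of_nat (Stirling (l + n) n)
          * of_int (stirling1_signed (k - 1) j) * fact j)
        / (fact (l + n) * fact (k - 1) * fact (j - l))
        * (x - 1) ^ (j - l))"
proof -
  define t :: "nat \<Rightarrow> nat \<Rightarrow> nat \<Rightarrow> 'a" where
    "t j l k = (of_nat (n choose k) * 2 ^ k * of_nat (Stirling (l + n) n)
          * of_int (stirling1_signed (k - 1) j) * fact j)
        / (fact (l + n) * fact (k - 1) * fact (j - l))
        * (x - 1) ^ (j - l)" for j l k
  \<comment> \<open>Only n! moves inside, as part of the coefficients of A^n; (n-1)! is left to
    match the left-hand side.\<close>
  have "fact n * (\<Sum>j=0..n-1. \<Sum>l=0..j. \<Sum>k=j+1..n. t j l k)
      = (\<Sum>j=0..n-1. \<Sum>k=j+1..n. \<Sum>l=0..j. fact n * t j l k)"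
    by (subst sum.swap [where B = "{_ + 1..n}"]) (simp add: sum_distrib_left)
  also have "\<dots> = (\<Sum>k=1..n. \<Sum>j=0..k-1. \<Sum>l=0..j. fact n * t j l k)"
  proof -
    define u where "u j k = (\<Sum>l=0..j. fact n * t j l k)" for j k
    \<comment> \<open>Both orders of summation run over the triangle 0 \<le> j < k \<le> n.\<close>
    have "(\<Sum>j=0..n-1. \<Sum>k=j+1..n. u j k) = (\<Sum>k=1..n. \<Sum>j=0..k-1. u j k)"
      unfolding sum.Sigma [OF finite_atLeastAtMost ballI [OF finite_atLeastAtMost]]
      by (rule sum.reindex_bij_witness [of _ prod.swap prod.swap]) auto
    then show ?thesis by (simp only: u_def)
  qed
  also have "\<dots> = (\<Sum>k=1..n. of_nat (n choose k) * 2 ^ k *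
        (fps_exp x * fps_expdiff ^ (n - k)) $ (k - 1))"
  proof (rule sum.cong)
    fix k assume "k \<in> {1..n}"
    then have "1 \<le> k" "k \<le> n" by auto
    from sum_stirling_products_eq_nth [OF this, of x, symmetric]
    show "(\<Sum>j=0..k-1. \<Sum>l=0..j. fact n * t j l k)
        = of_nat (n choose k) * 2 ^ k * (fps_exp x * fps_expdiff ^ (n - k)) $ (k - 1)"
      by (simp add: t_def sum_distrib_left mult_ac)
  qed simp
  also have "\<dots> = (fps_exp x * (1 + fps_exp 1) ^ n) $ (n - 1)"
    by (rule exp_mult_one_plus_exp_power_nth [OF assms, symmetric])
  finally have nth: "fact n * (\<Sum>j=0..n-1. \<Sum>l=0..j. \<Sum>k=j+1..n. t j l k)
      = (fps_exp x * (1 + fps_exp 1) ^ n) $ (n - 1)" .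
  show ?thesis
    unfolding sum_binomial_power_eq_nth nth [symmetric] t_def by (simp only: mult_ac)
qed

end
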